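(* Let $N=\{1,\ldots,n\}$ and let a submodular function $f:2^N\to\mathbb{R}$, a supermodular function $g:2^N\to\mathbb{R}$, and vectors $a \in \mathbb{R}^n_{>0}$ and $b \in \mathbb{R}^n$ be given. Then the following hold: (i) any least weakly $(a,b)$-supermajorized element of $P(f^{-b})$ is also a least weakly absolutely $(a,b)$-majorized element of $P(f)$; (ii) any least weakly $(a,b)$-submajorized element of $P_{\text{sup}}(g^{-b})$ is also a least weakly absolutely $(a,b)$-majorized element of $P_{\text{sup}}(g)$. Moreover, if $f$, $g$, and $b$ are integral, then also the following hold: (iii) any least weakly $(1,b)$-supermajorized element of $P^{\mathbb{Z}}(f^{-b})$ is also a least weakly absolutely $(1,b)$-majorized element of $P^{\mathbb{Z}}(f)$; (iv) any least weakly $(1,b)$-submajorized element of $P^{\mathbb{Z}}_{\text{sup}}(g^{-b})$ is also a least weakly absolutely $(1,b)$-majorized element of $P^{\mathbb{Z}}_{\text{sup}}(g)$.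
   Context: Notation: $x(A) := \sum_{i\in A} x_i$ for $x\in\mathbb{R}^n$, $A\subseteq N$; in "$(1,b)$", $1$ is the all-ones vector; "integral" means integer-valued. $f:2^N\to\mathbb{R}$ with $f(\emptyset)=0$ is submodular if $f(A)+f(B)\ge f(A\cup B)+f(A\cap B)$ for all $A,B\subseteq N$; $g$ is supermodular if $-g$ is submodular. $P(f):=\{x\in\mathbb{R}^n : x(A)\le f(A)\ \forall A\subseteq N\}$, $P_{\text{sup}}(g):=\{x\in\mathbb{R}^n : x(A)\ge g(A)\ \forall A\subseteq N\}$, and $P^{\mathbb{Z}}(f)$, $P^{\mathbb{Z}}_{\text{sup}}(g)$ are their intersections with $\mathbb{Z}^n$. For $v\in\mathbb{R}^n$, the reduction of $f$ by $v$ is $f^v(A):=\min\{f(Z)+v(A\setminus Z): Z\subseteq A\}$ and the reduction of $g$ by $v$ is $g^v(A):=\max\{g(Z)+v(A\setminus Z): Z\subseteq A\}$, $A\subseteq N$. (It is known that $f^v$ is submodular with $P(f^v)=\{x\in P(f): x\le v\}$ and $g^v$ is supermodular with $P_{\text{sup}}(g^v)=\{x\in P_{\text{sup}}(g): x\ge v\}$, and likewise for the integral versions.) Majorization: for $a\in\mathbb{R}^n_{>0}$, $b\in\mathbb{R}^n$ and $x,y\in\mathbb{R}^n$, consider the inequality $\sum_{i\in N} a_i\phi\left(\frac{x_i+b_i}{a_i}\right)\le \sum_{i\in N} a_i\phi\left(\frac{y_i+b_i}{a_i}\right)$ ( * ). Then $x$ is weakly $(a,b)$-submajorized (resp. weakly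 $(a,b)$-supermajorized, weakly absolutely $(a,b)$-majorized) by $y$ if ( * ) holds for all non-decreasing (resp. non-increasing, even) continuous convex $\phi:\mathbb{R}\to\mathbb{R}$. For $C\subseteq\mathbb{R}^n$, $x\in C$ is a least weakly $(a,b)$-submajorized (resp. least weakly $(a,b)$-supermajorized, least weakly absolutely $(a,b)$-majorized) element of $C$ if it is so majorized by every $y\in C$. *)

theory Defs
  imports "HOL-Analysis.Analysis"
begin

(* The ground set N = {1,...,n} is the universe of a finite index type 'n; vectors in R^n have
   type real ^ 'n, and set functions on 2^N have type 'n set => real. *)

definition sum_over :: "real ^ 'n \<Rightarrow> 'n set \<Rightarrow> real" where
  "sum_over x A = (\<Sum>i\<in>A. x $ i)"

(* Submodular and supermodular functions are normalized: they vanish on the empty set. *)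

definition submodular :: "('n::finite set \<Rightarrow> real) \<Rightarrow> bool" where
  "submodular f \<longleftrightarrow> f {} = 0 \<and> (\<forall>A B. f A + f B \<ge> f (A \<union> B) + f (A \<inter> B))"

definition supermodular :: "('n::finite set \<Rightarrow> real) \<Rightarrow> bool" where
  "supermodular g \<longleftrightarrow> submodular (\<lambda>A. - g A)"

definition polyhedron_sub :: "('n::finite set \<Rightarrow> real) \<Rightarrow> (real ^ 'n) set" where
  "polyhedron_sub f = {x. \<forall>A. sum_over x A \<le> f A}"

definition polyhedron_sup :: "('n::finite set \<Rightarrow> real) \<Rightarrow> (real ^ 'n) set" where
  "polyhedron_sup g = {x. \<forall>A. sum_over x A \<ge> g A}"

definition integral_points :: "(real ^ 'n::finite) set" where
  "integral_points = {x. \<forall>i. x $ i \<in> \<int>}"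

definition polyhedron_sub_int :: "('n::finite set \<Rightarrow> real) \<Rightarrow> (real ^ 'n) set" where
  "polyhedron_sub_int f = polyhedron_sub f \<inter> integral_points"

definition polyhedron_sup_int :: "('n::finite set \<Rightarrow> real) \<Rightarrow> (real ^ 'n) set" where
  "polyhedron_sup_int g = polyhedron_sup g \<inter> integral_points"

definition reduction_sub :: "('n::finite set \<Rightarrow> real) \<Rightarrow> real ^ 'n \<Rightarrow> 'n set \<Rightarrow> real" where
  "reduction_sub f v A = Min {f Z + sum_over v (A - Z) | Z. Z \<subseteq> A}"

definition reduction_sup :: "('n::finite set \<Rightarrow> real) \<Rightarrow> real ^ 'n \<Rightarrow> 'n set \<Rightarrow> real" where
  "reduction_sup g v A = Max {g Z + sum_over v (A - Z) | Z. Z \<subseteq> A}"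

definition major_sum :: "real ^ 'n::finite \<Rightarrow> real ^ 'n \<Rightarrow> (real \<Rightarrow> real) \<Rightarrow> real ^ 'n \<Rightarrow> real" where
  "major_sum a b \<phi> x = (\<Sum>i\<in>UNIV. a $ i * \<phi> ((x $ i + b $ i) / a $ i))"

(* In the three relations below, x is the majorized and y the majorizing vector. *)

definition weakly_submajorized ::
  "real ^ 'n::finite \<Rightarrow> real ^ 'n \<Rightarrow> real ^ 'n \<Rightarrow> real ^ 'n \<Rightarrow> bool" where
  "weakly_submajorized a b x y \<longleftrightarrow>
     (\<forall>\<phi>. mono \<phi> \<and> continuous_on UNIV \<phi> \<and> convex_on UNIV \<phi> \<longrightarrow>
        major_sum a b \<phi> x \<le> major_sum a b \<phi> y)"

definition weakly_supermajorized ::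
  "real ^ 'n::finite \<Rightarrow> real ^ 'n \<Rightarrow> real ^ 'n \<Rightarrow> real ^ 'n \<Rightarrow> bool" where
  "weakly_supermajorized a b x y \<longleftrightarrow>
     (\<forall>\<phi>. antimono \<phi> \<and> continuous_on UNIV \<phi> \<and> convex_on UNIV \<phi> \<longrightarrow>
        major_sum a b \<phi> x \<le> major_sum a b \<phi> y)"

definition weakly_abs_majorized ::
  "real ^ 'n::finite \<Rightarrow> real ^ 'n \<Rightarrow> real ^ 'n \<Rightarrow> real ^ 'n \<Rightarrow> bool" where
  "weakly_abs_majorized a b x y \<longleftrightarrow>
     (\<forall>\<phi>. (\<forall>t. \<phi> (- t) = \<phi> t) \<and> continuous_on UNIV \<phi> \<and> convex_on UNIV \<phi> \<longrightarrow>
        major_sum a b \<phi> x \<le> major_sum a b \<phi> y)"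

definition least_element :: "('a \<Rightarrow> 'a \<Rightarrow> bool) \<Rightarrow> 'a set \<Rightarrow> 'a \<Rightarrow> bool" where
  "least_element R C x \<longleftrightarrow> x \<in> C \<and> (\<forall>y\<in>C. R x y)"

end

theory Submission
  imports Defs
begin

text \<open>
  An even convex function \<open>\<phi>\<close> is minimal at \<open>0\<close> and monotone in the absolute value, so it agrees on
  the nonpositive half-line with the non-increasing convex function \<open>t \<mapsto> \<phi> (min t 0)\<close>. All points
  of \<open>P(f\<^sup>-\<^sup>b)\<close> satisfy \<open>x + b \<le> 0\<close>, and replacing any \<open>y \<in> P(f)\<close> by \<open>min y (-b)\<close>, which lies in
  \<open>P(f\<^sup>-\<^sup>b)\<close>, can only decrease the sum belonging to \<open>\<phi>\<close>. The supermodular case follows by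
  reflection at the origin.
\<close>

section \<open>Even convex functions and truncation of the argument\<close>

text \<open>The point \<open>t\<close> lies between \<open>- s\<close> and \<open>s\<close>, so it
  is a convex combination of two points at which \<open>\<phi>\<close> takes the same value
  \<open>\<phi> s\<close>.\<close>

lemma even_convex_abs_le:
  fixes \<phi> :: "real \<Rightarrow> real"
  assumes even: "\<And>t. \<phi> (- t) = \<phi> t" and cvx: "convex_on UNIV \<phi>" and le: "\<bar>t\<bar> \<le> \<bar>s\<bar>"
  shows "\<phi> t \<le> \<phi> s"
proof (cases "s = 0")
  case True
  with le show ?thesis by simp
next
  case False
  \<comment> \<open>This weight solves \<open>(1 - l) * (- s) + l * s = t\<close>; the bound on
    \<open>\<bar>t / s\<bar>\<close> puts it into the unit interval.\<close>
  define l where "l = (1 + t / s) / 2"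
  have "\<bar>t / s\<bar> \<le> 1"
    using False le by (simp add: abs_divide)
  then have l: "0 \<le> l" "l \<le> 1"
    unfolding l_def abs_le_iff by simp_all
  have "\<phi> ((1 - l) * (- s) + l * s) \<le> (1 - l) * \<phi> (- s) + l * \<phi> s"
    using convex_onD[OF cvx l, of "- s" s] by simp
  moreover have "(1 - l) * (- s) + l * s = t"
    using False by (simp add: l_def field_simps)
  ultimately show ?thesis
    by (simp add: even algebra_simps)
qed

text \<open>A non-increasing convex function composed with a concave one is convex, and
  \<open>min t c\<close> is concave in \<open>t\<close>. Monotonicity is asked for only up to
  \<open>c\<close>, the range of the truncation, so that an even function qualifies with
  \<open>c = 0\<close>.\<close>

lemma convex_on_antimono_comp_min:
  fixes \<phi> :: "real \<Rightarrow> real"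
  assumes cvx: "convex_on UNIV \<phi>" and anti: "\<And>s t. s \<le> t \<Longrightarrow> t \<le> c \<Longrightarrow> \<phi> t \<le> \<phi> s"
  shows "convex_on UNIV (\<lambda>t. \<phi> (min t c))"
proof (intro convex_onI convex_UNIV)
  fix u x y :: real
  assume u: "0 < u" "u < 1"
  have "(1 - u) * min x c + u * min y c \<le> (1 - u) * x + u * y"
    using u by (intro add_mono mult_left_mono) auto
  moreover have "(1 - u) * min x c + u * min y c \<le> (1 - u) * c + u * c"
    using u by (intro add_mono mult_left_mono) auto
  \<comment> \<open>Concavity of the truncation: the combination is below both arguments of the
    right-hand minimum.\<close>
  ultimately have "(1 - u) * min x c + u * min y c \<le> min ((1 - u) * x + u * y) c"
    by (simp add: algebra_simps)
  then have "\<phi> (min ((1 - u) * x + u * y) c) \<le> \<phi> ((1 - u) * min x c + u * min y c)"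
    by (intro anti) auto
  also have "\<dots> \<le> (1 - u) * \<phi> (min x c) + u * \<phi> (min y c)"
    using convex_onD[OF cvx, of u "min x c" "min y c"] u by simp
  finally show "\<phi> (min ((1 - u) *\<^sub>R x + u *\<^sub>R y) c) \<le> (1 - u) * \<phi> (min x c) + u * \<phi> (min y c)"
    by simp
qed

section \<open>From least weakly supermajorized to least weakly absolutely majorized\<close>

text \<open>The set \<open>C\<close> is abstract, with closure under truncation at
  \<open>- b\<close> as its only property, so that both a polyhedron and its integral points are
  covered. The sums form a chain: \<open>\<phi>\<close> at \<open>x\<close> equals
  \<open>\<psi>\<close> at \<open>x\<close>, which is at most \<open>\<psi>\<close> at
  \<open>y'\<close>, which is at most \<open>\<phi>\<close> at \<open>y\<close>.\<close>

lemma least_abs_majorized_of_least_supermajorized: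
  fixes a b x :: "real ^ 'n::finite"
  assumes a: "\<forall>i. a $ i > 0"
    and min_closed: "\<And>y. y \<in> C \<Longrightarrow> (\<chi> i. min (y $ i) (- b $ i)) \<in> C"
    and least: "least_element (weakly_supermajorized a b) {y \<in> C. \<forall>i. y $ i \<le> - b $ i} x"
  shows "least_element (weakly_abs_majorized a b) C x"
  unfolding least_element_def weakly_abs_majorized_def
proof (intro conjI ballI allI impI)
  show "x \<in> C"
    using least by (simp add: least_element_def)
next
  fix y and \<phi> :: "real \<Rightarrow> real"
  assume y: "y \<in> C"
    and \<phi>: "(\<forall>t. \<phi> (- t) = \<phi> t) \<and> continuous_on UNIV \<phi> \<and> convex_on UNIV \<phi>"
  have abs_le: "\<phi> t \<le> \<phi> s" if "\<bar>t\<bar> \<le> \<bar>s\<bar>" for s t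
    using even_convex_abs_le \<phi> that by blast
  define \<psi> where "\<psi> t = \<phi> (min t 0)" for t
  define y' where "y' = (\<chi> i. min (y $ i) (- b $ i))"
  have "antimono \<psi>"
    unfolding \<psi>_def by (intro antimonoI abs_le) auto
  moreover have "continuous_on UNIV \<psi>"
    unfolding \<psi>_def using \<phi> continuous_on_compose2[of UNIV \<phi> UNIV "\<lambda>t. min t 0"]
    by (simp add: continuous_on_min)
  moreover have "convex_on UNIV \<psi>"
    unfolding \<psi>_def using \<phi> by (intro convex_on_antimono_comp_min abs_le) auto
  moreover have "y' \<in> {y \<in> C. \<forall>i. y $ i \<le> - b $ i}"
    using min_closed[OF y] by (simp add: y'_def)
  ultimately have le: "major_sum a b \<psi> x \<le> major_sum a b \<psi> y'"
    using least by (auto simp: least_element_def weakly_supermajorized_def)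
  have "x $ i \<le> - b $ i" for i
    using least by (simp add: least_element_def)
  then have xb: "x $ i + b $ i \<le> 0" for i
    by (metis add_mono add.left_inverse order_refl)
  \<comment> \<open>Division by the positive \<open>a $ i\<close> keeps the argument nonpositive, so
    \<open>\<phi>\<close> and \<open>\<psi>\<close> agree there.\<close>
  have "min ((x $ i + b $ i) / a $ i) 0 = (x $ i + b $ i) / a $ i" for i
    using xb[of i] a by (simp add: min_def divide_le_0_iff not_less less_imp_le)
  then have "major_sum a b \<phi> x = major_sum a b \<psi> x"
    by (simp add: major_sum_def \<psi>_def)
  also note le
  also have "major_sum a b \<psi> y' \<le> major_sum a b \<phi> y"
    unfolding major_sum_def \<psi>_def
  proof (intro sum_mono mult_left_mono abs_le)
    fix i
    \<comment> \<open>After the shift by \<open>b\<close>, truncation at \<open>- b\<close> is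
      truncation at 0: each entry is kept or becomes 0, so no absolute value grows.\<close>
    have "y' $ i + b $ i = min (y $ i + b $ i) 0"
      by (simp add: y'_def min_def)
    then show "\<bar>min ((y' $ i + b $ i) / a $ i) 0\<bar> \<le> \<bar>(y $ i + b $ i) / a $ i\<bar>"
      using a[rule_format, of i]
      by (cases "y $ i + b $ i \<le> 0") (simp_all add: min_absorb1 min_absorb2 divide_nonpos_pos)
    show "0 \<le> a $ i"
      using a by (simp add: less_imp_le)
  qed
  finally show "major_sum a b \<phi> x \<le> major_sum a b \<phi> y" .
qed

section \<open>Reflection at the origin\<close>

text \<open>Negating both the vector and \<open>b\<close> negates every argument of
  \<open>\<phi>\<close>, which an even function does not notice.\<close>

lemma weakly_abs_majorized_uminus:
  "weakly_abs_majorized a (- b) (- x) (- y) \<longleftrightarrow> weakly_abs_majorized a b x y"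
proof -
  have "major_sum a (- b) \<phi> (- z) = major_sum a b \<phi> z" if "\<forall>t. \<phi> (- t) = \<phi> t" for \<phi> and z
    using that[rule_format, of "(z $ i + b $ i) / a $ i" for i]
    by (simp add: major_sum_def minus_divide_left)
  then show ?thesis
    by (simp add: weakly_abs_majorized_def cong: conj_cong imp_cong)
qed

text \<open>Testing the reflected vectors with \<open>\<phi>\<close> is testing the original ones
  with \<open>\<phi> (- t)\<close>, which is again continuous and convex but non-decreasing.\<close>

lemma weakly_supermajorized_uminus:
  assumes "weakly_submajorized a b x y"
  shows "weakly_supermajorized a (- b) (- x) (- y)"
  unfolding weakly_supermajorized_def
proof (intro allI impI)
  fix \<phi> :: "real \<Rightarrow> real"
  assume \<phi>: "antimono \<phi> \<and> continuous_on UNIV \<phi> \<and> convex_on UNIV \<phi>"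
  define \<psi> where "\<psi> t = \<phi> (- t)" for t
  have "mono \<psi>"
    using \<phi> by (auto simp: \<psi>_def mono_def antimono_def)
  moreover have "continuous_on UNIV \<psi>"
    unfolding \<psi>_def using \<phi> continuous_on_compose2[of UNIV \<phi> UNIV uminus]
    by (simp add: continuous_on_minus)
  moreover have "convex_on UNIV \<psi>"
  proof (intro convex_onI convex_UNIV)
    fix u x y :: real
    assume "0 < u" "u < 1"
    then show "\<psi> ((1 - u) *\<^sub>R x + u *\<^sub>R y) \<le> (1 - u) * \<psi> x + u * \<psi> y"
      using \<phi> convex_onD[of UNIV \<phi> u "- x" "- y"] by (simp add: \<psi>_def algebra_simps)
  qed
  ultimately have "major_sum a b \<psi> x \<le> major_sum a b \<psi> y"
    using assms by (simp add: weakly_submajorized_def)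
  then show "major_sum a (- b) \<phi> (- x) \<le> major_sum a (- b) \<phi> (- y)"
    by (simp add: major_sum_def \<psi>_def minus_divide_left)
qed

text \<open>The supermajorized version is applied to the reflected data \<open>- b\<close>,
  \<open>- x\<close> and the image of \<open>C\<close> under \<open>uminus\<close>; the conclusion
  is then reflected back.\<close>

lemma least_abs_majorized_of_least_submajorized:
  fixes a b x :: "real ^ 'n::finite"
  assumes a: "\<forall>i. a $ i > 0"
    and max_closed: "\<And>y. y \<in> C \<Longrightarrow> (\<chi> i. max (y $ i) (- b $ i)) \<in> C"
    and least: "least_element (weakly_submajorized a b) {y \<in> C. \<forall>i. - b $ i \<le> y $ i} x"
  shows "least_element (weakly_abs_majorized a b) C x"
proof -
  have "least_element (weakly_abs_majorized a (- b)) (uminus ` C) (- x)"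
  proof (rule least_abs_majorized_of_least_supermajorized[OF a])
    fix y
    assume "y \<in> uminus ` C"
    then have "(\<chi> i. max ((- y) $ i) (- b $ i)) \<in> C"
      using max_closed by auto
    \<comment> \<open>Reflection exchanges min and max: cutting \<open>y\<close> from above at
      \<open>b\<close> is the reflection of cutting \<open>- y\<close> from below at
      \<open>- b\<close>.\<close>
    moreover have "(\<chi> i. min (y $ i) (- (- b) $ i)) = - (\<chi> i. max ((- y) $ i) (- b $ i))"
      by (simp add: vec_eq_iff min_def max_def)
    ultimately show "(\<chi> i. min (y $ i) (- (- b) $ i)) \<in> uminus ` C"
      by blast
  next
    \<comment> \<open>For \<open>y = - z\<close> the upper bound by \<open>b\<close> is the lower
      bound by \<open>- b\<close> on \<open>z\<close>, so the reflected constraint set is the right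
      one.\<close>
    show "least_element (weakly_supermajorized a (- b))
        {y \<in> uminus ` C. \<forall>i. y $ i \<le> - (- b) $ i} (- x)"
      using least weakly_supermajorized_uminus
      by (fastforce simp: least_element_def minus_le_iff)
  qed
  then show ?thesis
    by (auto simp: least_element_def weakly_abs_majorized_uminus)
qed

section \<open>Polyhedra of reductions\<close>

lemma sum_over_Diff:
  fixes x :: "real ^ 'n::finite"
  assumes "Z \<subseteq> A"
  shows "sum_over x A = sum_over x Z + sum_over x (A - Z)"
  unfolding sum_over_def using assms by (subst sum.subset_diff[of Z A]) (simp_all add: add.commute)


text \<open>A bound by a minimum is a bound by each of its terms, so membership becomes a family of
  inequalities over all \<open>Z \<subseteq> A\<close>. They follow by splitting \<open>A\<close>
  into \<open>Z\<close>, bounded through \<open>f\<close>, and \<open>A - Z\<close>, bounded through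
  \<open>v\<close>.\<close>

lemma polyhedron_sub_reduction:
  fixes f :: "'n::finite set \<Rightarrow> real"
  assumes "f {} = 0"
  shows "polyhedron_sub (reduction_sub f v) = {x \<in> polyhedron_sub f. \<forall>i. x $ i \<le> v $ i}"
proof -
  have red: "x \<in> polyhedron_sub (reduction_sub f v) \<longleftrightarrow>
      (\<forall>A Z. Z \<subseteq> A \<longrightarrow> sum_over x A \<le> f Z + sum_over v (A - Z))" for x
    unfolding polyhedron_sub_def reduction_sub_def by (subst mem_Collect_eq, subst Min_ge_iff) auto
  have "sum_over x A \<le> f Z + sum_over v (A - Z)"
    if "\<forall>A. sum_over x A \<le> f A" "\<forall>i. x $ i \<le> v $ i" "Z \<subseteq> A" for x A Z
  proof -
    have "sum_over x (A - Z) \<le> sum_over v (A - Z)"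
      using that by (auto simp: sum_over_def intro: sum_mono)
    then show ?thesis
      using that by (simp add: sum_over_Diff[of Z A] add_mono)
  qed
  \<comment> \<open>The extreme choices of \<open>Z\<close> give the converse: \<open>Z = {}\<close>
    in a singleton yields the coordinate bound, by \<open>f {} = 0\<close>, and \<open>Z = A\<close>
    yields the bound by \<open>f\<close>.\<close>
  moreover have "x $ i \<le> v $ i"
    if "\<forall>A Z. Z \<subseteq> A \<longrightarrow> sum_over x A \<le> f Z + sum_over v (A - Z)" for x i
    using that[rule_format, of "{}" "{i}"] assms by (simp add: sum_over_def)
  moreover have "sum_over x A \<le> f A"
    if "\<forall>A Z. Z \<subseteq> A \<longrightarrow> sum_over x A \<le> f Z + sum_over v (A - Z)" for x A
    using that[rule_format, of A A] by (simp add: sum_over_def)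
  ultimately show ?thesis
    unfolding set_eq_iff red by (auto simp: polyhedron_sub_def)
qed

text \<open>The same argument with all inequalities reversed and the maximum in place of the
  minimum.\<close>

lemma polyhedron_sup_reduction:
  fixes g :: "'n::finite set \<Rightarrow> real"
  assumes "g {} = 0"
  shows "polyhedron_sup (reduction_sup g v) = {x \<in> polyhedron_sup g. \<forall>i. v $ i \<le> x $ i}"
proof -
  have red: "x \<in> polyhedron_sup (reduction_sup g v) \<longleftrightarrow>
      (\<forall>A Z. Z \<subseteq> A \<longrightarrow> g Z + sum_over v (A - Z) \<le> sum_over x A)" for x
    unfolding polyhedron_sup_def reduction_sup_def by (subst mem_Collect_eq, subst Max_le_iff) auto
  have "g Z + sum_over v (A - Z) \<le> sum_over x A"
    if "\<forall>A. g A \<le> sum_over x A" "\<forall>i. v $ i \<le> x $ i" "Z \<subseteq> A" for x A Z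
  proof -
    have "sum_over v (A - Z) \<le> sum_over x (A - Z)"
      using that by (auto simp: sum_over_def intro: sum_mono)
    then show ?thesis
      using that by (simp add: sum_over_Diff[of Z A] add_mono)
  qed
  moreover have "v $ i \<le> x $ i"
    if "\<forall>A Z. Z \<subseteq> A \<longrightarrow> g Z + sum_over v (A - Z) \<le> sum_over x A" for x i
    using that[rule_format, of "{}" "{i}"] assms by (simp add: sum_over_def)
  moreover have "g A \<le> sum_over x A"
    if "\<forall>A Z. Z \<subseteq> A \<longrightarrow> g Z + sum_over v (A - Z) \<le> sum_over x A" for x A
    using that[rule_format, of A A] by (simp add: sum_over_def)
  ultimately show ?thesis
    unfolding set_eq_iff red by (auto simp: polyhedron_sup_def)
qed

lemma polyhedron_sub_downward_closed:
  assumes "y \<in> polyhedron_sub f" "\<And>i. x $ i \<le> y $ i"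
  shows "x \<in> polyhedron_sub f"
proof -
  have "sum_over x A \<le> sum_over y A" for A
    using assms(2) by (auto simp: sum_over_def intro: sum_mono)
  then show ?thesis
    using assms(1) order_trans unfolding polyhedron_sub_def by blast
qed

lemma polyhedron_sup_upward_closed:
  assumes "y \<in> polyhedron_sup g" "\<And>i. y $ i \<le> x $ i"
  shows "x \<in> polyhedron_sup g"
proof -
  have "sum_over y A \<le> sum_over x A" for A
    using assms(2) by (auto simp: sum_over_def intro: sum_mono)
  then show ?thesis
    using assms(1) order_trans unfolding polyhedron_sup_def by blast
qed

section \<open>The four statements for real and integral polyhedra\<close>

theorem lemma12:
  fixes f g :: "'n::finite set \<Rightarrow> real" and a b :: "real ^ 'n"
  assumes "submodular f"
    and "supermodular g"
    and "\<forall>i. a $ i > 0"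
  shows "(\<forall>x. least_element (weakly_supermajorized a b) (polyhedron_sub (reduction_sub f (- b))) x \<longrightarrow>
              least_element (weakly_abs_majorized a b) (polyhedron_sub f) x) \<and>
         (\<forall>x. least_element (weakly_submajorized a b) (polyhedron_sup (reduction_sup g (- b))) x \<longrightarrow>
              least_element (weakly_abs_majorized a b) (polyhedron_sup g) x) \<and>
         ((\<forall>A. f A \<in> \<int>) \<and> (\<forall>A. g A \<in> \<int>) \<and> b \<in> integral_points \<longrightarrow>
           (\<forall>x. least_element (weakly_supermajorized 1 b) (polyhedron_sub_int (reduction_sub f (- b))) x \<longrightarrow>
                least_element (weakly_abs_majorized 1 b) (polyhedron_sub_int f) x) \<and>
           (\<forall>x. least_element (weakly_submajorized 1 b) (polyhedron_sup_int (reduction_sup g (- b))) x \<longrightarrow>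
                least_element (weakly_abs_majorized 1 b) (polyhedron_sup_int g) x))"
proof (intro conjI allI impI)
  have f0: "f {} = 0" and g0: "g {} = 0"
    using assms by (auto simp: supermodular_def submodular_def)
  have one: "\<forall>i. (1 :: real ^ 'n) $ i > 0"
    by simp
  \<comment> \<open>Truncation from above only lowers coordinates and truncation from below only
    raises them; this gives the closure conditions on \<open>C\<close>.\<close>
  have min_sub: "(\<chi> i. min (y $ i) (- b $ i)) \<in> polyhedron_sub f" if "y \<in> polyhedron_sub f" for y
    using that by (rule polyhedron_sub_downward_closed) simp
  have max_sup: "(\<chi> i. max (y $ i) (- b $ i)) \<in> polyhedron_sup g" if "y \<in> polyhedron_sup g" for y
    using that by (rule polyhedron_sup_upward_closed) simp
  \<comment> \<open>With \<open>v = - b\<close>, the polyhedra of the reductions are exactly the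
    constrained sets over which leastness is assumed in the abstract lemmas.\<close>
  note sub = polyhedron_sub_reduction[of f "- b", OF f0]
  note sup = polyhedron_sup_reduction[of g "- b", OF g0]
  {
    fix x
    assume "least_element (weakly_supermajorized a b) (polyhedron_sub (reduction_sub f (- b))) x"
    then show "least_element (weakly_abs_majorized a b) (polyhedron_sub f) x"
      unfolding sub using assms(3) min_sub
      by (intro least_abs_majorized_of_least_supermajorized) auto
  next
    fix x
    assume "least_element (weakly_submajorized a b) (polyhedron_sup (reduction_sup g (- b))) x"
    then show "least_element (weakly_abs_majorized a b) (polyhedron_sup g) x"
      unfolding sup using assms(3) max_sup
      by (intro least_abs_majorized_of_least_submajorized) auto
  next
    fix x
    assume int: "(\<forall>A. f A \<in> \<int>) \<and> (\<forall>A. g A \<in> \<int>) \<and> b \<in> integral_points"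
    {
      assume "least_element (weakly_supermajorized 1 b) (polyhedron_sub_int (reduction_sub f (- b))) x"
      moreover have eq: "polyhedron_sub_int (reduction_sub f (- b)) =
          {y \<in> polyhedron_sub_int f. \<forall>i. y $ i \<le> - b $ i}"
        by (auto simp: polyhedron_sub_int_def sub)
      \<comment> \<open>Each entry of the minimum is one of the integers \<open>y $ i\<close> and
        \<open>- b $ i\<close>; this is where integrality of \<open>b\<close> enters.\<close>
      moreover have "(\<chi> i. min (y $ i) (- b $ i)) \<in> polyhedron_sub_int f"
        if "y \<in> polyhedron_sub_int f" for y
        using that int min_sub[of y]
        by (auto simp: polyhedron_sub_int_def integral_points_def min_def)
      ultimately show "least_element (weakly_abs_majorized 1 b) (polyhedron_sub_int f) x"
        unfolding eq by (intro least_abs_majorized_of_least_supermajorized[OF one]) auto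
    next
      assume "least_element (weakly_submajorized 1 b) (polyhedron_sup_int (reduction_sup g (- b))) x"
      moreover have eq: "polyhedron_sup_int (reduction_sup g (- b)) =
          {y \<in> polyhedron_sup_int g. \<forall>i. - b $ i \<le> y $ i}"
        by (auto simp: polyhedron_sup_int_def sup)
      moreover have "(\<chi> i. max (y $ i) (- b $ i)) \<in> polyhedron_sup_int g"
        if "y \<in> polyhedron_sup_int g" for y
        using that int max_sup[of y]
        by (auto simp: polyhedron_sup_int_def integral_points_def max_def)
      ultimately show "least_element (weakly_abs_majorized 1 b) (polyhedron_sup_int g) x"
        unfolding eq by (intro least_abs_majorized_of_least_submajorized[OF one]) auto
    }
  }
qed

end
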